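(* Let $G=(V,E)$ be a graph with $V=[n]$ and $|E|=m$, and let $Z_G\subset\mathbb{R}^n$ be its graphic zonotope. For any $x\in Z_G$ there exist a forest $F\subset G$ and a random tournament $X=(p_{ij})_{(i,j)\in E,\,i<j}$ on $G$ with mean score sequence $x$ such that for every edge $(i,j)\in E$ (with $i<j$) with $(i,j)\notin E(F)$ we have $p_{ij}=0$ or $p_{ij}=1$. Furthermore, if $x\in\mathbb{Z}^n$, then the same is true for $(i,j)\in E(F)$, i.e. $p_{ij}\in\{0,1\}$ for these edges as well; hence, in this case, $x$ is the score sequence of a (deterministic) tournament on $G$.
   Context: Here $[n]=\{1,\ldots,n\}$ and $e_1,\ldots,e_n$ is the standard basis of $\mathbb{R}^n$. Graphs are finite, undirected and simple (no loops or multiple edges); each edge is written $(i,j)$ with $i<j$ when an order of its endpoints is needed. The graphic zonotope of $G=(V,E)$ is the Minkowski sum of line segments $$Z_G=\sum_{\substack{(i,j)\in E\\ i<j}}[e_i,e_j]\subset\mathbb{R}^n.$$ A forest $F\subset G$ is a subgraph of $G$ containing no cycles, and $E(F)$ is its edge set. A tournament on $G$ is an orientation of the edges of $G$, each edge being directed towards the winner of the match between its endpoints; its score sequence $s=(s_1,\ldots,s_n)$ lists the number of wins of each vertex, i.e. $s_i$ is the number of edges directed towards $i$. A random tournament on $G$ is a collection of real numbers $p_{ij}\in[0,1]$, one for each edge $(i,j)\in E$ with $i<j$ ($p_{ij}$ is interpreted as the probability that team $i$ beats team $j$, and $1-p_{ij}$ as the probability that $j$ beats $i$). The mean score sequence $x=(x_1,\ldots,x_n)$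 of a random tournament is given by $$x_i=\sum_{\substack{j>i\\(i,j)\in E}}p_{ij}+\sum_{\substack{j<i\\(i,j)\in E}}(1-p_{ji}),$$ where in the second sum $(i,j)\in E$ means that the edge joining $j$ and $i$ belongs to $E$. *)

theory Defs
  imports "HOL-Analysis.Analysis" "HOL-Library.Set_Algebras"
begin

type_synonym 'a graph = "'a set \<times> 'a set set"

abbreviation verts :: "'a graph \<Rightarrow> 'a set" where
  "verts G \<equiv> fst G"

abbreviation edges :: "'a graph \<Rightarrow> 'a set set" where
  "edges G \<equiv> snd G"

definition simple_graph :: "'a graph \<Rightarrow> bool" where
  "simple_graph G \<longleftrightarrow> finite (verts G) \<and> (\<forall>e\<in>edges G. e \<subseteq> verts G \<and> card e = 2)"

definition subgraph :: "'a graph \<Rightarrow> 'a graph \<Rightarrow> bool" where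
  "subgraph H G \<longleftrightarrow> simple_graph H \<and> verts H \<subseteq> verts G \<and> edges H \<subseteq> edges G"

text \<open>A cycle is given by its list of pairwise distinct vertices; the index is taken modulo
  the length, so the edge closing the cycle is included.\<close>

definition is_cycle :: "'a graph \<Rightarrow> 'a list \<Rightarrow> bool" where
  "is_cycle G c \<longleftrightarrow> 3 \<le> length c \<and> distinct c \<and>
     (\<forall>k<length c. {c ! k, c ! (Suc k mod length c)} \<in> edges G)"

definition forest :: "'a graph \<Rightarrow> bool" where
  "forest F \<longleftrightarrow> simple_graph F \<and> (\<nexists>c. is_cycle F c)"

text \<open>The vertex set \<open>[n]\<close> with its usual order is modelled by a finite linearly ordered type
  \<open>'n\<close> with \<open>n = CARD('n)\<close>, so that \<open>\<real>\<^sup>n\<close> is \<^typ>\<open>real ^ 'n\<close> and \<open>e\<^sub>i\<close> is \<open>axis i 1\<close>.\<close>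

definition ordered_edges :: "'a::linorder graph \<Rightarrow> ('a \<times> 'a) set" where
  "ordered_edges G = {(i, j). i < j \<and> {i, j} \<in> edges G}"

text \<open>The sum below is the Minkowski sum of sets.\<close>

definition graphic_zonotope :: "'n::{finite,linorder} graph \<Rightarrow> (real, 'n) vec set" where
  "graphic_zonotope G = (\<Sum>(i, j)\<in>ordered_edges G. closed_segment (axis i 1) (axis j 1))"

text \<open>An orientation is a set of arcs; the arc \<open>(i, j)\<close> is directed towards \<open>j\<close>, the winner.\<close>

definition tournament :: "'a graph \<Rightarrow> ('a \<times> 'a) set \<Rightarrow> bool" where
  "tournament G T \<longleftrightarrow> (\<forall>(i, j)\<in>T. {i, j} \<in> edges G) \<and>
     (\<forall>i j. {i, j} \<in> edges G \<longrightarrow> ((i, j) \<in> T \<longleftrightarrow> (j, i) \<notin> T))"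

definition score :: "('a \<times> 'a) set \<Rightarrow> 'a \<Rightarrow> nat" where
  "score T i = card {a \<in> T. snd a = i}"

text \<open>Only the values \<open>p i j\<close> with \<open>(i, j) \<in> ordered_edges G\<close> are relevant;
  \<open>p i j\<close> is the probability that \<open>i\<close> beats \<open>j\<close>.\<close>

definition random_tournament :: "'a::linorder graph \<Rightarrow> ('a \<Rightarrow> 'a \<Rightarrow> real) \<Rightarrow> bool" where
  "random_tournament G p \<longleftrightarrow> (\<forall>(i, j)\<in>ordered_edges G. p i j \<in> {0..1})"

definition mean_score :: "'n::{finite,linorder} graph \<Rightarrow> ('n \<Rightarrow> 'n \<Rightarrow> real) \<Rightarrow> (real, 'n) vec" where
  "mean_score G p = (\<chi> i. (\<Sum>j | j > i \<and> {i, j} \<in> edges G. p i j)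
                        + (\<Sum>j | j < i \<and> {j, i} \<in> edges G. 1 - p j i))"

end

theory Submission
  imports Defs
begin

text \<open>
  Writing a point \<open>x\<close> of the zonotope as a sum of points of the segments \<open>[e\<^sub>i, e\<^sub>j]\<close> and reading off
  their barycentric coordinates gives a random tournament with mean score sequence \<open>x\<close>
  (lemma \<open>graphic_zonotope_mean_score\<close>).  Among all of these, choose one with the fewest
  \<^emph>\<open>fractional\<close> edges, that is, edges whose probability is neither \<open>0\<close> nor \<open>1\<close>.

  The fractional edges then form the required forest.  If they contained a cycle, one could add a
  multiple of the unit circulation around it.  A circulation does not change the mean scores, and
  increasing the multiple until the first probability hits \<open>0\<close> or \<open>1\<close> yields a random tournament
  with fewer fractional edges (lemma \<open>cycle_improvement\<close>).

  If \<open>x\<close> is integral, this forest has no edges at all.  Otherwise it has a leaf (lemma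
  \<open>forest_has_leaf\<close>), and the mean score of that leaf is the sum of one number strictly between \<open>0\<close>
  and \<open>1\<close> and of several numbers in \<open>{0, 1}\<close>, hence not an integer (lemma
  \<open>integral_score_not_leaf\<close>).  Without fractional edges, the random tournament is an ordinary one.
\<close>

section \<open>Leaves of forests\<close>

text \<open>An end vertex of a longest path is a leaf: any further neighbour would either extend
  the path or lie on it and close a cycle.\<close>

lemma forest_has_leaf:
  assumes "forest F" and "edges F \<noteq> {}"
  obtains v w where "{v, w} \<in> edges F" and "\<And>u. {v, u} \<in> edges F \<Longrightarrow> u = w"
proof -
  have fin: "finite (verts F)" and E: "\<And>e. e \<in> edges F \<Longrightarrow> e \<subseteq> verts F \<and> card e = 2"
    and nocyc: "\<And>c. \<not> is_cycle F c"
    using assms(1) by (auto simp: forest_def simple_graph_def)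
  define path where "path c \<longleftrightarrow> 2 \<le> length c \<and> distinct c \<and> set c \<subseteq> verts F \<and>
    (\<forall>k. Suc k < length c \<longrightarrow> {c ! k, c ! Suc k} \<in> edges F)" for c
  obtain e where e: "e \<in> edges F" using assms(2) by auto
  then obtain a b where ab: "e = {a, b}" "a \<noteq> b"
    using E by (meson card_2_iff)
  have ex: "path [a, b]"
    using e ab E[OF e] by (auto simp: path_def)
  have "length c < Suc (card (verts F))" if "path c" for c
    using that fin by (metis card_mono distinct_card less_Suc_eq_le path_def)
  then obtain c where c: "path c" and max: "\<And>d. path d \<Longrightarrow> length d \<le> length c"
    using ex_has_greatest_nat[of path "[a, b]" length "Suc (card (verts F))"] ex
    by (metis less_imp_le)
  have len: "2 \<le> length c" and dist: "distinct c" and sub: "set c \<subseteq> verts F"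
    and step: "\<And>k. Suc k < length c \<Longrightarrow> {c ! k, c ! Suc k} \<in> edges F"
    using c by (auto simp: path_def)
  have edge: "{c ! 0, c ! 1} \<in> edges F" using step[of 0] len by simp
  have "u = c ! 1" if u: "{c ! 0, u} \<in> edges F" for u
  proof (rule ccontr)
    assume ne: "u \<noteq> c ! 1"
    have u0: "u \<noteq> c ! 0" using E[OF u] by auto
    have "u \<in> set c"
    proof (rule ccontr)
      assume "u \<notin> set c"
      then have "path (u # c)"
        using len dist sub step u E[OF u]
        by (auto simp: path_def nth_Cons insert_commute split: nat.splits)
      then show False using max by fastforce
    qed
    then obtain k where k: "k < length c" "u = c ! k"
      by (auto simp: in_set_conv_nth)
    then have k2: "2 \<le> k" using u0 ne by (cases k; cases "k - 1") auto
    have "is_cycle F (take (Suc k) c)"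
      unfolding is_cycle_def
    proof (intro conjI allI impI)
      fix l assume "l < length (take (Suc k) c)"
      then have l: "l < Suc k" using k by simp
      have length_take: "length (take (Suc k) c) = Suc k" using k by simp
      have "{take (Suc k) c ! l, take (Suc k) c ! (Suc l mod Suc k)} \<in> edges F"
      proof (cases "l = k")
        case True
        then show ?thesis using k u by (simp add: insert_commute)
      next
        case False
        then show ?thesis using k l step[of l] by simp
      qed
      then show "{take (Suc k) c ! l, take (Suc k) c ! (Suc l mod length (take (Suc k) c))} \<in> edges F"
        by (simp only: length_take)
    qed (use k k2 dist in auto)
    then show False using nocyc by blast
  qed
  with edge show thesis by (rule that)
qed

section \<open>The unit circulation around a closed walk\<close>

text \<open>How often the closed walk \<open>c\<close> traverses \<open>i j\<close> forwards minus how often it does so backwards.\<close>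

definition circulation :: "'a list \<Rightarrow> 'a \<Rightarrow> 'a \<Rightarrow> real" where
  "circulation c i j = (\<Sum>k<length c.
     of_bool (i = c ! k \<and> j = c ! (Suc k mod length c)) -
     of_bool (j = c ! k \<and> i = c ! (Suc k mod length c)))"

lemma circulation_antisym: "circulation c j i = - circulation c i j"
  by (simp add: circulation_def flip: sum_negf)

lemma circulation_support:
  assumes "circulation c i j \<noteq> 0"
  obtains k where "k < length c" and "{i, j} = {c ! k, c ! (Suc k mod length c)}"
proof -
  obtain k where "k < length c" "of_bool (i = c ! k \<and> j = c ! (Suc k mod length c)) -
     of_bool (j = c ! k \<and> i = c ! (Suc k mod length c)) \<noteq> (0::real)"
    using assms unfolding circulation_def by (meson lessThan_iff sum.neutral)
  then show thesis
    using that[of k] by (auto simp: of_bool_def insert_commute split: if_splits)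
qed

lemma bij_betw_Suc_mod:
  "bij_betw (\<lambda>k. Suc k mod n) {..<n} {..<n}"
proof (cases "n = 0")
  case False
  have "inj_on (\<lambda>k. Suc k mod n) {..<n}"
    by (auto simp: inj_on_def mod_Suc split: if_splits)
  moreover have "(\<lambda>k. Suc k mod n) ` {..<n} \<subseteq> {..<n}"
    using False by auto
  ultimately show ?thesis
    by (metis endo_inj_surj finite_lessThan bij_betw_def)
qed simp

text \<open>A closed walk leaves each vertex as often as it enters it.\<close>

lemma circulation_conservation:
  "(\<Sum>j\<in>UNIV. circulation c (i :: 'a :: finite) j) = 0"
proof -
  let ?n = "length c"
  have single: "(\<Sum>j\<in>UNIV. of_bool (P \<and> j = a)) = (of_bool P :: real)" for P and a :: 'a
    by (cases P) (auto simp: of_bool_def)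
  have single': "(\<Sum>j\<in>UNIV. of_bool (j = a \<and> P)) = (of_bool P :: real)" for P and a :: 'a
    by (cases P) (auto simp: of_bool_def)
  have "(\<Sum>j\<in>UNIV. circulation c i j) =
      (\<Sum>k<?n. \<Sum>j\<in>UNIV. of_bool (i = c ! k \<and> j = c ! (Suc k mod ?n)) -
         of_bool (j = c ! k \<and> i = c ! (Suc k mod ?n)))"
    unfolding circulation_def by (rule sum.swap)
  also have "\<dots> = (\<Sum>k<?n. of_bool (i = c ! k)) - (\<Sum>k<?n. of_bool (i = c ! (Suc k mod ?n)))"
    by (simp add: sum_subtractf single single')
  also have "(\<Sum>k<?n. of_bool (i = c ! (Suc k mod ?n))) = (\<Sum>k<?n. of_bool (i = c ! k) :: real)"
    by (rule sum.reindex_bij_betw[OF bij_betw_Suc_mod])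
  finally show ?thesis by simp
qed

text \<open>On a cycle of length at least three no edge is traversed twice, so nothing cancels.\<close>

lemma circulation_first_edge:
  assumes "distinct c" and "3 \<le> length c"
  shows "circulation c (c ! 0) (c ! 1) = 1"
proof -
  let ?n = "length c"
  have "circulation c (c ! 0) (c ! 1) = (\<Sum>k<?n. of_bool (k = 0))"
    unfolding circulation_def
  proof (rule sum.cong[OF refl])
    fix k assume "k \<in> {..<?n}"
    then have k: "k < ?n" by simp
    have s: "Suc k mod ?n < ?n"
      by (rule mod_less_divisor) (use k in linarith)
    have idx: "c ! a = c ! b \<longleftrightarrow> a = b" if "a < ?n" "b < ?n" for a b
      using that assms(1) by (simp add: nth_eq_iff_index_eq)
    have "0 < ?n" "1 < ?n" using assms(2) by linarith+
    note eqs = idx[OF this(1) k] idx[OF this(2) k] idx[OF this(1) s] idx[OF this(2) s]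
    show "of_bool (c ! 0 = c ! k \<and> c ! 1 = c ! (Suc k mod ?n)) -
        of_bool (c ! 1 = c ! k \<and> c ! 0 = c ! (Suc k mod ?n)) = (of_bool (k = 0) :: real)"
    proof (cases "k = 0 \<or> k = 1")
      case True
      then show ?thesis unfolding eqs using assms(2) by auto
    next
      case False
      then show ?thesis unfolding eqs by simp
    qed
  qed
  also have "\<dots> = 1"
    using assms(2) by (subst sum.remove[of _ 0]) auto
  finally show ?thesis .
qed

section \<open>Mean scores\<close>

text \<open>Covering both orders of the endpoints of an edge turns a mean score into a single sum over
  the neighbours of a vertex, and lets an antisymmetric function be added to the probabilities.\<close>

definition win_prob :: "('a::linorder \<Rightarrow> 'a \<Rightarrow> real) \<Rightarrow> 'a \<Rightarrow> 'a \<Rightarrow> real" where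
  "win_prob p i j = (if i < j then p i j else 1 - p j i)"

lemma simple_graph_neq: "simple_graph G \<Longrightarrow> {i, j} \<in> edges G \<Longrightarrow> i \<noteq> j"
  by (auto simp: simple_graph_def)

lemma win_prob_swap: "i \<noteq> j \<Longrightarrow> win_prob p j i = 1 - win_prob p i j"
  by (auto simp: win_prob_def)

lemma mean_score_win_prob:
  fixes G :: "'n::{finite,linorder} graph"
  assumes "simple_graph G"
  shows "mean_score G p $ i = (\<Sum>j | {i, j} \<in> edges G. win_prob p i j)"
proof -
  have split: "{j. {i, j} \<in> edges G} = {j. j > i \<and> {i, j} \<in> edges G} \<union> {j. j < i \<and> {j, i} \<in> edges G}"
    using simple_graph_neq[OF assms] by (auto simp: insert_commute neq_iff)
  have "(\<Sum>j | {i, j} \<in> edges G. win_prob p i j) =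
      (\<Sum>j | j > i \<and> {i, j} \<in> edges G. win_prob p i j) + (\<Sum>j | j < i \<and> {j, i} \<in> edges G. win_prob p i j)"
    unfolding split by (rule sum.union_disjoint) auto
  also have "\<dots> = mean_score G p $ i"
    unfolding mean_score_def by (auto simp: win_prob_def intro!: arg_cong2[of _ _ _ _ "(+)"] sum.cong)
  finally show ?thesis ..
qed

text \<open>On the segment \<open>[e\<^sub>i, e\<^sub>j]\<close>, the weight of \<open>e\<^sub>i\<close> serves as the probability that \<open>i\<close> wins.\<close>

lemma graphic_zonotope_mean_score:
  fixes G :: "'n::{finite,linorder} graph"
  assumes "x \<in> graphic_zonotope G"
  obtains p where "random_tournament G p" and "mean_score G p = x"
proof -
  let ?O = "ordered_edges G"
  obtain v where x: "x = sum v ?O"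
    and v: "\<And>a. a \<in> ?O \<Longrightarrow> v a \<in> (case a of (i, j) \<Rightarrow> closed_segment (axis i 1) (axis j 1))"
    using assms unfolding graphic_zonotope_def by (auto simp: set_sum_alt)
  have "\<exists>u. 0 \<le> u \<and> u \<le> 1 \<and> v (i, j) = (1 - u) *\<^sub>R axis i 1 + u *\<^sub>R axis j 1"
    if "(i, j) \<in> ?O" for i j
    using v[OF that] by (auto simp: closed_segment_def)
  then obtain u where u: "\<And>i j. (i, j) \<in> ?O \<Longrightarrow>
      0 \<le> u i j \<and> u i j \<le> 1 \<and> v (i, j) = (1 - u i j) *\<^sub>R axis i 1 + u i j *\<^sub>R axis j 1"
    by metis
  define p where "p i j = 1 - u i j" for i j
  have "random_tournament G p"
    using u by (auto simp: random_tournament_def p_def)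
  moreover have "mean_score G p = x"
  proof (rule vec_eq_iff[THEN iffD2], rule allI)
    fix l
    have "x $ l = (\<Sum>(i, j)\<in>?O. of_bool (i = l) * p i j + of_bool (j = l) * (1 - p i j))"
      unfolding x sum_component by (rule sum.cong) (auto simp: u p_def axis_def)
    also have "\<dots> = (\<Sum>(i, j)\<in>?O. if i = l then p i j else 0) + (\<Sum>(i, j)\<in>?O. if j = l then 1 - p i j else 0)"
      by (auto simp flip: sum.distrib intro!: sum.cong)
    also have "(\<Sum>(i, j)\<in>?O. if i = l then p i j else 0) = (\<Sum>j | j > l \<and> {l, j} \<in> edges G. p l j)"
    proof -
      have "(\<Sum>(i, j)\<in>?O. if i = l then p i j else 0) = (\<Sum>(i, j)\<in>{a \<in> ?O. fst a = l}. p i j)"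
        by (rule sum.mono_neutral_cong_right) (auto split: if_splits)
      also have "\<dots> = (\<Sum>j | j > l \<and> {l, j} \<in> edges G. p l j)"
        by (rule sum.reindex_bij_witness[where i = "\<lambda>j. (l, j)" and j = snd])
          (auto simp: ordered_edges_def)
      finally show ?thesis .
    qed
    also have "(\<Sum>(i, j)\<in>?O. if j = l then 1 - p i j else 0) = (\<Sum>i | i < l \<and> {i, l} \<in> edges G. 1 - p i l)"
    proof -
      have "(\<Sum>(i, j)\<in>?O. if j = l then 1 - p i j else 0) = (\<Sum>(i, j)\<in>{a \<in> ?O. snd a = l}. 1 - p i j)"
        by (rule sum.mono_neutral_cong_right) (auto split: if_splits)
      also have "\<dots> = (\<Sum>i | i < l \<and> {i, l} \<in> edges G. 1 - p i l)"
        by (rule sum.reindex_bij_witness[where i = "\<lambda>i. (i, l)" and j = fst])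
          (auto simp: ordered_edges_def)
      finally show ?thesis .
    qed
    finally show "mean_score G p $ l = x $ l"
      by (simp add: mean_score_def)
  qed
  ultimately show thesis by (rule that)
qed

lemma random_tournament_win_prob:
  assumes "random_tournament G p" and "simple_graph G" and "{i, j} \<in> edges G"
  shows "win_prob p i j \<in> {0..1}"
  using assms simple_graph_neq[of G i j]
  by (cases "i < j")
    (auto simp: random_tournament_def ordered_edges_def win_prob_def insert_commute)

section \<open>Fractional edges\<close>

definition fractional_edges :: "'a::linorder graph \<Rightarrow> ('a \<Rightarrow> 'a \<Rightarrow> real) \<Rightarrow> 'a set set" where
  "fractional_edges G p = {{i, j} |i j. i < j \<and> {i, j} \<in> edges G \<and> p i j \<notin> {0, 1}}"

lemma fractional_edges_iff:
  assumes "simple_graph G"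
  shows "{i, j} \<in> fractional_edges G p \<longleftrightarrow> {i, j} \<in> edges G \<and> win_prob p i j \<notin> {0, 1}"
proof -
  have ordered: "{a, b} \<in> fractional_edges G p \<longleftrightarrow> {a, b} \<in> edges G \<and> p a b \<notin> {0, 1}"
    if "a < b" for a b
    using that by (auto simp: fractional_edges_def doubleton_eq_iff)
  show ?thesis
  proof (cases i j rule: linorder_cases)
    case less
    then show ?thesis by (simp add: ordered win_prob_def)
  next
    case equal
    then show ?thesis
      using simple_graph_neq[OF assms, of i j] by (auto simp: fractional_edges_def)
  next
    case greater
    then show ?thesis using ordered[of j i] by (auto simp: win_prob_def insert_commute)
  qed
qed

lemma fractional_edges_subset: "fractional_edges G p \<subseteq> edges G"
  by (auto simp: fractional_edges_def)

text \<open>Moving along a line out of the open unit cube, there is a first moment at which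
  the boundary is reached.\<close>

lemma line_exits_unit_cube:
  fixes u f :: "'a \<Rightarrow> real"
  assumes "finite S" and "\<And>s. s \<in> S \<Longrightarrow> 0 < u s \<and> u s < 1" and "s0 \<in> S" and "f s0 \<noteq> 0"
  obtains t where "\<And>s. s \<in> S \<Longrightarrow> u s + t * f s \<in> {0..1}"
    and "\<exists>s\<in>S. u s + t * f s \<in> {0, 1}"
proof -
  \<comment> \<open>the time at which coordinate \<open>s\<close> reaches the face towards which it moves\<close>
  define h where "h s = (if f s > 0 then (1 - u s) / f s else - u s / f s)" for s
  let ?T = "{s \<in> S. f s \<noteq> 0}"
  have "finite ?T" "?T \<noteq> {}" using assms by auto
  then obtain m where m: "m \<in> ?T" and min: "\<And>s. s \<in> ?T \<Longrightarrow> h m \<le> h s"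
    using obtains_Min[of "h ` ?T"]
    by (smt (verit) finite_imageI image_iff image_is_empty Min_in Min_le imageI)
  have pos: "0 \<le> h m"
    using m assms(2)[of m] by (auto simp: h_def field_simps not_less)
  have "u s + h m * f s \<in> {0..1}" if s: "s \<in> S" for s
  proof (cases "f s" "0::real" rule: linorder_cases)
    case less
    then have "h m * f s \<ge> h s * f s" using min s by (simp add: mult_right_mono_neg)
    moreover have "h s * f s = - u s" using less by (simp add: h_def)
    moreover have "h m * f s \<le> 0" using pos less by (simp add: mult_nonneg_nonpos)
    ultimately show ?thesis using assms(2)[OF s] by auto
  next
    case equal
    then show ?thesis using assms(2)[OF s] by auto
  next
    case greater
    then have "h m * f s \<le> h s * f s" using min s by (simp add: mult_right_mono)
    moreover have "h s * f s = 1 - u s" using greater by (simp add: h_def)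
    moreover have "0 \<le> h m * f s" using pos greater by simp
    ultimately show ?thesis using assms(2)[OF s] by auto
  qed
  moreover have "u m + h m * f m \<in> {0, 1}"
    using m by (auto simp: h_def)
  ultimately show thesis using m that by blast
qed

text \<open>Pushing the unit circulation around a cycle of fractional edges, until some edge of the cycle
  becomes deterministic, preserves the mean scores.\<close>

lemma cycle_improvement:
  fixes G :: "'n::{finite,linorder} graph"
  assumes G: "simple_graph G" and p: "random_tournament G p"
    and cyc: "is_cycle (V, fractional_edges G p) c"
  obtains q where "random_tournament G q" and "mean_score G q = mean_score G p"
    and "fractional_edges G q \<subset> fractional_edges G p"
proof -
  let ?f = "circulation c"
  let ?S = "{(i, j). {i, j} \<in> fractional_edges G p}"
  have len: "3 \<le> length c" and dist: "distinct c"
    and ce: "\<And>k. k < length c \<Longrightarrow> {c ! k, c ! (Suc k mod length c)} \<in> fractional_edges G p"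
    using cyc by (auto simp: is_cycle_def)
  have supp: "{i, j} \<in> fractional_edges G p" if "?f i j \<noteq> 0" for i j
    using that ce by (metis circulation_support)
  have inside: "0 < win_prob p (fst s) (snd s) \<and> win_prob p (fst s) (snd s) < 1" if "s \<in> ?S" for s
    using that random_tournament_win_prob[OF p G, of "fst s" "snd s"]
    by (fastforce simp: fractional_edges_iff[OF G])
  have start: "?f (c ! 0) (c ! 1) \<noteq> 0"
    using circulation_first_edge[OF dist len] by simp
  obtain t where t: "\<And>s. s \<in> ?S \<Longrightarrow> win_prob p (fst s) (snd s) + t * ?f (fst s) (snd s) \<in> {0..1}"
    and hit: "\<exists>s\<in>?S. win_prob p (fst s) (snd s) + t * ?f (fst s) (snd s) \<in> {0, 1}"
    using line_exits_unit_cube[of ?S "\<lambda>s. win_prob p (fst s) (snd s)" "(c ! 0, c ! 1)"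
        "\<lambda>s. ?f (fst s) (snd s)"] inside start supp[OF start] by auto
  define q where "q i j = p i j + t * ?f i j" for i j
  have wq: "win_prob q i j = win_prob p i j + t * ?f i j" for i j
    using circulation_antisym[of c i j] by (simp add: win_prob_def q_def)
  have off: "?f i j = 0" if "{i, j} \<notin> fractional_edges G p" for i j
    using supp that by blast
  have "random_tournament G q"
    unfolding random_tournament_def
  proof (clarify)
    fix i j assume "(i, j) \<in> ordered_edges G"
    then have ij: "i < j" "{i, j} \<in> edges G" by (auto simp: ordered_edges_def)
    have "win_prob q i j \<in> {0..1}"
      using t[of "(i, j)"] off[of i j] random_tournament_win_prob[OF p G ij(2)]
      by (cases "{i, j} \<in> fractional_edges G p") (auto simp: wq)
    then show "q i j \<in> {0..1}" using ij by (simp add: win_prob_def)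
  qed
  moreover have "mean_score G q = mean_score G p"
  proof (rule vec_eq_iff[THEN iffD2], rule allI)
    fix i
    have "(\<Sum>j | {i, j} \<in> edges G. ?f i j) = (\<Sum>j\<in>UNIV. ?f i j)"
      using off fractional_edges_subset[of G p] by (intro sum.mono_neutral_left) auto
    then show "mean_score G q $ i = mean_score G p $ i"
      by (simp add: mean_score_win_prob[OF G] wq sum.distrib circulation_conservation
          flip: sum_distrib_left)
  qed
  moreover have "fractional_edges G q \<subset> fractional_edges G p"
  proof
    show "fractional_edges G q \<subseteq> fractional_edges G p"
    proof
      fix e assume e: "e \<in> fractional_edges G q"
      then obtain i j where ij: "e = {i, j}" by (auto simp: fractional_edges_def)
      show "e \<in> fractional_edges G p"
        using e off[of i j] by (auto simp: ij fractional_edges_iff[OF G] wq)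
    qed
    show "fractional_edges G q \<noteq> fractional_edges G p"
      using hit fractional_edges_iff[OF G, of _ _ q] by (auto simp: wq)
  qed
  ultimately show thesis by (rule that)
qed

section \<open>Integral scores\<close>

text \<open>At a leaf of the fractional edges, all other edges contribute \<open>0\<close> or \<open>1\<close> to the mean score, so
  integrality would force the one remaining probability to be an integer, too.\<close>

lemma integral_score_not_leaf:
  fixes G :: "'n::{finite,linorder} graph"
  assumes G: "simple_graph G" and p: "random_tournament G p"
    and int: "mean_score G p $ v \<in> \<int>"
    and frac: "{v, w} \<in> fractional_edges G p"
  shows "\<exists>u. {v, u} \<in> fractional_edges G p \<and> u \<noteq> w"
proof (rule ccontr)
  assume "\<nexists>u. {v, u} \<in> fractional_edges G p \<and> u \<noteq> w"
  then have leaf: "\<And>u. {v, u} \<in> fractional_edges G p \<Longrightarrow> u = w" by blast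
  have w: "{v, w} \<in> edges G" "win_prob p v w \<notin> {0, 1}"
    using frac by (auto simp: fractional_edges_iff[OF G])
  let ?N = "{j. {v, j} \<in> edges G}"
  have "mean_score G p $ v = win_prob p v w + (\<Sum>j\<in>?N - {w}. win_prob p v j)"
    using w unfolding mean_score_win_prob[OF G] by (intro sum.remove) auto
  moreover have "(\<Sum>j\<in>?N - {w}. win_prob p v j) \<in> \<int>"
  proof (rule Ints_sum)
    fix j assume "j \<in> ?N - {w}"
    then have "win_prob p v j \<in> {0, 1}"
      using leaf[of j] fractional_edges_iff[OF G, of v j p] by blast
    then show "win_prob p v j \<in> \<int>" by auto
  qed
  ultimately have "win_prob p v w \<in> \<int>"
    using int by (metis Ints_diff add_diff_cancel_right')
  then obtain z where "win_prob p v w = of_int z" by (auto elim: Ints_cases)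
  then show False
    using w(2) random_tournament_win_prob[OF p G w(1)] by auto
qed

lemma deterministic_tournament:
  fixes G :: "'n::{finite,linorder} graph"
  assumes G: "simple_graph G" and det: "fractional_edges G p = {}"
  obtains T where "tournament G T" and "mean_score G p = (\<chi> i. real (score T i))"
proof -
  have p01: "win_prob p i j = 0 \<or> win_prob p i j = 1" if "{i, j} \<in> edges G" for i j
    using that det fractional_edges_iff[OF G, of i j p] by auto
  define T where "T = {(j, i). {i, j} \<in> edges G \<and> win_prob p i j = 1}"
  have "tournament G T"
    unfolding tournament_def
  proof (intro conjI allI impI)
    show "\<forall>(i, j)\<in>T. {i, j} \<in> edges G"
      by (auto simp: T_def insert_commute)
  next
    fix i j assume ij: "{i, j} \<in> edges G"
    then show "(i, j) \<in> T \<longleftrightarrow> (j, i) \<notin> T"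
      using p01[OF ij] win_prob_swap[OF simple_graph_neq[OF G ij], of p]
      by (auto simp: T_def insert_commute)
  qed
  moreover have "mean_score G p $ i = real (score T i)" for i
  proof -
    let ?W = "{j. {i, j} \<in> edges G \<and> win_prob p i j = 1}"
    have "{a \<in> T. snd a = i} = (\<lambda>j. (j, i)) ` ?W"
      by (auto simp: T_def)
    then have "score T i = card ?W"
      by (simp add: score_def card_image inj_on_def)
    moreover have "mean_score G p $ i = (\<Sum>j\<in>?W. win_prob p i j)"
      unfolding mean_score_win_prob[OF G]
      using p01 by (intro sum.mono_neutral_right) auto
    ultimately show ?thesis by simp
  qed
  ultimately show thesis
    using that by (simp add: vec_eq_iff)
qed

section \<open>Random tournaments with few fractional edges\<close>

theorem theorem5:
  fixes G :: "'n::{finite,linorder} graph" and x :: "(real, 'n) vec"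
  assumes "simple_graph G" and "verts G = UNIV"
    and "x \<in> graphic_zonotope G"
  shows "\<exists>F p. subgraph F G \<and> forest F \<and> random_tournament G p \<and> mean_score G p = x \<and>
           (\<forall>i j. i < j \<and> {i, j} \<in> edges G \<and> {i, j} \<notin> edges F \<longrightarrow> p i j = 0 \<or> p i j = 1) \<and>
           ((\<forall>i. x $ i \<in> \<int>) \<longrightarrow>
             (\<forall>i j. i < j \<and> {i, j} \<in> edges F \<longrightarrow> p i j = 0 \<or> p i j = 1) \<and>
             (\<exists>T. tournament G T \<and> x = (\<chi> i. real (score T i))))"
proof -
  note G = assms(1)
  let ?good = "\<lambda>p. random_tournament G p \<and> mean_score G p = x"
  obtain p0 where "?good p0"
    using graphic_zonotope_mean_score[OF assms(3)] by blast
  then obtain p where p: "random_tournament G p" "mean_score G p = x"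
    and min: "\<And>q. ?good q \<Longrightarrow> card (fractional_edges G p) \<le> card (fractional_edges G q)"
    using ex_has_least_nat[of ?good p0 "\<lambda>p. card (fractional_edges G p)"] by blast
  define F where "F = (UNIV :: 'n set, fractional_edges G p)"
  have sub: "subgraph F G"
    using G assms(2) fractional_edges_subset[of G p]
    by (auto simp: subgraph_def simple_graph_def F_def)
  have forest: "forest F"
  proof -
    have "\<not> is_cycle F c" for c
    proof
      assume "is_cycle F c"
      then obtain q where "?good q" and "fractional_edges G q \<subset> fractional_edges G p"
        using cycle_improvement[OF G p(1)] p(2) unfolding F_def by metis
      then show False
        using min[of q] psubset_card_mono[of "fractional_edges G p" "fractional_edges G q"]
        by (metis finite leD)
    qed
    then show ?thesis using sub by (auto simp: forest_def subgraph_def)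
  qed
  have outside: "p i j = 0 \<or> p i j = 1"
    if "i < j" "{i, j} \<in> edges G" "{i, j} \<notin> edges F" for i j
    using that by (auto simp: F_def fractional_edges_def)
  have integral: "fractional_edges G p = {}" if "\<forall>i. x $ i \<in> \<int>"
  proof (rule ccontr)
    assume "fractional_edges G p \<noteq> {}"
    then obtain v w where "{v, w} \<in> fractional_edges G p"
      and "\<And>u. {v, u} \<in> fractional_edges G p \<Longrightarrow> u = w"
      using forest_has_leaf[OF forest] by (auto simp: F_def)
    then show False
      using integral_score_not_leaf[OF G p(1)] that p(2) by metis
  qed
  have "\<exists>T. tournament G T \<and> x = (\<chi> i. real (score T i))" if "\<forall>i. x $ i \<in> \<int>"
    using deterministic_tournament[OF G integral[OF that]] p(2) by metis
  then show ?thesis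
    using sub forest p outside integral
    by (intro exI[of _ F] exI[of _ p]) (simp add: F_def)
qed

end
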